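(* Let $k\ge 1$ and $n\ge 2$ be integers. The following are equivalent: (1) there exist $k$ mutually orthogonal Latin squares of order $n$; (2) $\mathsf{id}_{k+2}\le \mathsf{PHP}^{n^2}_{n}$. In particular, $\mathsf{id}_3\le\mathsf{PHP}^{n^2}_{n}$, and hence $\mathsf{PHP}^{n^2}_{n}<\mathsf{PHP}^{n^2+1}_{n}$ (i.e. $\mathsf{PHP}^{n^2+1}_{n}\le \mathsf{PHP}^{n^2}_{n}$ but $\mathsf{PHP}^{n^2}_{n}\not\le \mathsf{PHP}^{n^2+1}_{n}$).
   Context: A number $N\ge1$ is identified with $\{0,\dots,N-1\}$. A (finite) problem $\mathsf{P}$ consists of a nonempty finite set of instances and, for each instance $x$, a nonempty finite set $\mathsf{P}(x)$ of solutions. For finite problems $\mathsf{P},\mathsf{Q}$, write $\mathsf{P}\le\mathsf{Q}$ if there exist a map $\Phi$ sending each $\mathsf{P}$-instance $x$ to a $\mathsf{Q}$-instance $\Phi(x)$ and a (partial) map $\Psi$ on $\mathsf{Q}$-solutions such that for every $\mathsf{P}$-instance $x$ and every $y\in\mathsf{Q}(\Phi(x))$, $\Psi(y)\in\mathsf{P}(x)$ (note $\Psi$ does not have access to $x$). Write $\mathsf{P}<\mathsf{Q}$ if $\mathsf{P}\le\mathsf{Q}$ and $\mathsf{Q}\not\le\mathsf{P}$. For integers $m>n\ge2$, the problem $\mathsf{PHP}^m_n$ has as instances all functions $f:m\to n$, and the solutions to $f$ are all unordered pairs $\{i,j\}\subseteq m$ with $i\ne j$ and $f(i)=f(j)$.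 For $k\ge1$, the problem $\mathsf{id}_k$ has instances $j\in\{1,\dots,k\}$, each instance $j$ having unique solution $j$.
   Formalization: The displayed PHP^{n²}_n < PHP^{n²+1}_n contradicts its own "i.e." clause under the given definition of < and is false; the formal statement proves the reversed inequality PHP^{n²+1}_n < PHP^{n²}_n, which is exactly that clause. *)

theory Defs
  imports Main "HOL-Library.FuncSet"
begin

record ('i, 's) problem =
  instances :: "'i set"
  solutions :: "'i \<Rightarrow> 's set"

definition finite_problem :: "('i, 's) problem \<Rightarrow> bool" where
  "finite_problem P \<longleftrightarrow>
     finite (instances P) \<and> instances P \<noteq> {} \<and>
     (\<forall>x\<in>instances P. finite (solutions P x) \<and> solutions P x \<noteq> {})"

definition problem_le :: "('i, 's) problem \<Rightarrow> ('j, 't) problem \<Rightarrow> bool"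
    (infix "\<le>\<^sub>P" 50) where
  "P \<le>\<^sub>P Q \<longleftrightarrow>
     (\<exists>(\<Phi> :: 'i \<Rightarrow> 'j) (\<Psi> :: 't \<rightharpoonup> 's).
        (\<forall>x\<in>instances P. \<Phi> x \<in> instances Q) \<and>
        (\<forall>x\<in>instances P. \<forall>y\<in>solutions Q (\<Phi> x).
           \<exists>z. \<Psi> y = Some z \<and> z \<in> solutions P x))"

definition problem_less :: "('i, 's) problem \<Rightarrow> ('j, 't) problem \<Rightarrow> bool"
    (infix "<\<^sub>P" 50) where
  "P <\<^sub>P Q \<longleftrightarrow> P \<le>\<^sub>P Q \<and> \<not> Q \<le>\<^sub>P P"

text \<open>The extensional function space contains exactly one representative of each
  function from \<open>m = {0, \<dots>, m - 1}\<close> to \<open>n = {0, \<dots>, n - 1}\<close>; an unordered pair is a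
  two-element set.\<close>

definition PHP :: "nat \<Rightarrow> nat \<Rightarrow> (nat \<Rightarrow> nat, nat set) problem" where
  "PHP m n =
     \<lparr> instances = {..<m} \<rightarrow>\<^sub>E {..<n},
       solutions = (\<lambda>f. {{i, j} | i j. i < m \<and> j < m \<and> i \<noteq> j \<and> f i = f j}) \<rparr>"

definition id_problem :: "nat \<Rightarrow> (nat, nat) problem" where
  "id_problem k = \<lparr> instances = {1..k}, solutions = (\<lambda>j. {j}) \<rparr>"

lemma finite_problem_PHP:
  assumes "m > n" "n \<ge> 2"
  shows "finite_problem (PHP m n)"
proof -
  have "finite {{i, j} | i j. i < m \<and> j < m \<and> i \<noteq> j \<and> f i = f j}" for f :: "nat \<Rightarrow> nat"
    by (rule finite_subset[of _ "Pow {..<m}"]) auto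
  moreover have "{{i, j} | i j. i < m \<and> j < m \<and> i \<noteq> j \<and> f i = f j} \<noteq> {}"
    if "f \<in> {..<m} \<rightarrow>\<^sub>E {..<n}" for f :: "nat \<Rightarrow> nat"
  proof -
    have "f ` {..<m} \<subseteq> {..<n}"
      using that by auto
    then have "card (f ` {..<m}) < card {..<m}"
      using card_mono[of "{..<n}" "f ` {..<m}"] assms by simp
    then have "\<not> inj_on f {..<m}"
      by (rule pigeonhole)
    then obtain i j where "i < m" "j < m" "i \<noteq> j" "f i = f j"
      by (auto simp: inj_on_def)
    then show ?thesis
      by blast
  qed
  moreover have "({..<m} \<rightarrow>\<^sub>E {..<n}) \<noteq> {}"
    using assms by (auto simp: PiE_eq_empty_iff lessThan_empty_iff)
  ultimately show ?thesis
    unfolding finite_problem_def PHP_def problem.simps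
    by (intro conjI ballI finite_PiE finite_lessThan)
qed

lemma finite_problem_id: "k \<ge> 1 \<Longrightarrow> finite_problem (id_problem k)"
  by (auto simp: finite_problem_def id_problem_def)

text \<open>Arrays of order \<open>n\<close> are functions of a row and a column index, of which only the
  values at indices below \<open>n\<close> matter; the symbols are \<open>0, \<dots>, n - 1\<close>.\<close>

definition latin_square :: "nat \<Rightarrow> (nat \<Rightarrow> nat \<Rightarrow> nat) \<Rightarrow> bool" where
  "latin_square n L \<longleftrightarrow>
     (\<forall>i<n. bij_betw (\<lambda>j. L i j) {..<n} {..<n}) \<and>
     (\<forall>j<n. bij_betw (\<lambda>i. L i j) {..<n} {..<n})"

definition orthogonal_squares ::
    "nat \<Rightarrow> (nat \<Rightarrow> nat \<Rightarrow> nat) \<Rightarrow> (nat \<Rightarrow> nat \<Rightarrow> nat) \<Rightarrow> bool" where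
  "orthogonal_squares n L M \<longleftrightarrow>
     bij_betw (\<lambda>(i, j). (L i j, M i j)) ({..<n} \<times> {..<n}) ({..<n} \<times> {..<n})"

definition mutually_orthogonal_latin_squares ::
    "nat \<Rightarrow> nat \<Rightarrow> (nat \<Rightarrow> nat \<Rightarrow> nat \<Rightarrow> nat) \<Rightarrow> bool" where
  "mutually_orthogonal_latin_squares k n L \<longleftrightarrow>
     (\<forall>a<k. latin_square n (L a)) \<and>
     (\<forall>a<k. \<forall>b<k. a \<noteq> b \<longrightarrow> orthogonal_squares n (L a) (L b))"

end

theory Submission
  imports Defs
begin

text \<open>A reduction of \<open>id_K\<close> to \<open>PHP^m_n\<close> amounts to \<open>K\<close> functions \<open>m \<rightarrow> n\<close> no two of which
  have a common collision, that is, any two of which are jointly injective into \<open>n \<times> n\<close>. For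
  \<open>m = n\<^sup>2\<close> the joint maps are bijections: two of the functions serve as row and column
  coordinates, and the remaining ones, read in these coordinates, are mutually orthogonal Latin
  squares. For \<open>m > n\<^sup>2\<close> not even two such functions exist.\<close>

section \<open>Reductions: transitivity and monotonicity\<close>

lemma problem_le_trans:
  assumes "P \<le>\<^sub>P Q" and "Q \<le>\<^sub>P R"
  shows "P \<le>\<^sub>P R"
proof -
  obtain f g where f: "\<forall>x\<in>instances P. f x \<in> instances Q"
    and g: "\<forall>x\<in>instances P. \<forall>y\<in>solutions Q (f x). \<exists>z. g y = Some z \<and> z \<in> solutions P x"
    using assms(1) unfolding problem_le_def by blast
  obtain f' g' where f': "\<forall>x\<in>instances Q. f' x \<in> instances R"
    and g': "\<forall>x\<in>instances Q. \<forall>y\<in>solutions R (f' x). \<exists>z. g' y = Some z \<and> z \<in> solutions Q x"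
    using assms(2) unfolding problem_le_def by blast
  show ?thesis
    unfolding problem_le_def
  proof (intro exI[of _ "f' \<circ> f"] exI[of _ "g \<circ>\<^sub>m g'"] conjI ballI)
    fix x assume "x \<in> instances P"
    then show "(f' \<circ> f) x \<in> instances R"
      using f f' by simp
  next
    fix x y assume x: "x \<in> instances P" and y: "y \<in> solutions R ((f' \<circ> f) x)"
    then obtain z where "g' y = Some z" "z \<in> solutions Q (f x)"
      using f g' by fastforce
    moreover from this x obtain w where "g z = Some w" "w \<in> solutions P x"
      using g by blast
    ultimately show "\<exists>w. (g \<circ>\<^sub>m g') y = Some w \<and> w \<in> solutions P x"
      by (auto simp: map_comp_def)
  qed
qed

lemma id_problem_mono: "j \<le> k \<Longrightarrow> id_problem j \<le>\<^sub>P id_problem k"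
  unfolding problem_le_def id_problem_def
  by (intro exI[of _ id] exI[of _ Some]) auto

text \<open>More pigeons make the problem easier: a collision found among the first \<open>m\<close>
  pigeons is already a collision of the whole function, so solutions are returned unchanged.\<close>

lemma PHP_antimono:
  assumes "m \<le> m'"
  shows "PHP m' n \<le>\<^sub>P PHP m n"
  unfolding problem_le_def
proof (intro exI[of _ "\<lambda>f. restrict f {..<m}"] exI[of _ Some] conjI ballI)
  fix f assume "f \<in> instances (PHP m' n)"
  then show "restrict f {..<m} \<in> instances (PHP m n)"
    using assms by (auto simp: PHP_def PiE_iff)
next
  fix f y assume "y \<in> solutions (PHP m n) (restrict f {..<m})"
  then obtain i j where "y = {i, j}" "i < m" "j < m" "i \<noteq> j" "f i = f j"
    by (auto simp: PHP_def)
  then have "y \<in> solutions (PHP m' n) f"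
    using assms unfolding PHP_def by fastforce
  then show "\<exists>z. Some y = Some z \<and> z \<in> solutions (PHP m' n) f"
    by blast
qed

text \<open>The backward map sees only the pair, so a reduction exists iff no pair solves two of the
  chosen instances. A pair solves both \<open>F a\<close> and \<open>F b\<close> exactly when their
  joint map collides on it.\<close>

lemma id_le_PHP_iff:
  "id_problem K \<le>\<^sub>P PHP m n \<longleftrightarrow>
     (\<exists>F. (\<forall>a\<in>{1..K}. F a \<in> {..<m} \<rightarrow> {..<n}) \<and>
          (\<forall>a\<in>{1..K}. \<forall>b\<in>{1..K}. a \<noteq> b \<longrightarrow> inj_on (\<lambda>x. (F a x, F b x)) {..<m}))"
  (is "?L \<longleftrightarrow> (\<exists>F. ?R F)")
proof
  assume ?L
  then obtain F G where F: "\<forall>a\<in>{1..K}. F a \<in> {..<m} \<rightarrow>\<^sub>E {..<n}"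
    and G: "\<forall>a\<in>{1..K}. \<forall>y\<in>solutions (PHP m n) (F a). G y = Some a"
    unfolding problem_le_def by (auto simp: id_problem_def PHP_def)
  have "inj_on (\<lambda>x. (F a x, F b x)) {..<m}" if "a \<in> {1..K}" "b \<in> {1..K}" "a \<noteq> b" for a b
  proof (rule inj_onI, rule ccontr)
    fix x y assume "x \<in> {..<m}" "y \<in> {..<m}" "(F a x, F b x) = (F a y, F b y)" "x \<noteq> y"
    \<comment> \<open>On such a pair \<open>G\<close> would have to answer both \<open>a\<close> and
      \<open>b\<close>.\<close>
    then have "{x, y} \<in> solutions (PHP m n) (F a)" "{x, y} \<in> solutions (PHP m n) (F b)"
      unfolding PHP_def by auto
    then have "G {x, y} = Some a" "G {x, y} = Some b"
      using G that by blast+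
    then show False
      using that by simp
  qed
  then have "?R F"
    using F by (auto simp: PiE_iff)
  then show "\<exists>F. ?R F"
    by blast
next
  assume "\<exists>F. ?R F"
  then obtain F where F: "?R F" ..
  \<comment> \<open>Instances of \<open>PHP\<close> are extensional, hence the restriction.
    \<open>G\<close> decodes a pair to the index whose function collides on it; on other sets its
    value is arbitrary and never consulted.\<close>
  define F' where "F' a = restrict (F a) {..<m}" for a
  define G where "G y = Some (SOME a. a \<in> {1..K} \<and> y \<in> solutions (PHP m n) (F' a))" for y
  have unique: "a = b"
    if "a \<in> {1..K}" "b \<in> {1..K}"
      and y: "y \<in> solutions (PHP m n) (F' a)" "y \<in> solutions (PHP m n) (F' b)"
    for a b y
  proof (rule ccontr)
    assume "a \<noteq> b"
    then have "inj_on (\<lambda>x. (F a x, F b x)) {..<m}"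
      using F that by blast
    \<comment> \<open>The two solution sets may list the elements of \<open>y\<close> in opposite
      orders, which does not affect the equalities.\<close>
    moreover obtain i j where "i < m" "j < m" "i \<noteq> j" "F a i = F a j" "F b i = F b j"
      using y by (auto simp: PHP_def F'_def doubleton_eq_iff)
    ultimately show False
      by (auto dest: inj_onD)
  qed
  show ?L
    unfolding problem_le_def
  proof (intro exI[of _ F'] exI[of _ G] conjI ballI)
    fix a assume "a \<in> instances (id_problem K)"
    then show "F' a \<in> instances (PHP m n)"
      using F by (auto simp: id_problem_def PHP_def F'_def)
  next
    fix a y assume "a \<in> instances (id_problem K)" and y: "y \<in> solutions (PHP m n) (F' a)"
    then have a: "a \<in> {1..K}"
      by (simp add: id_problem_def)
    have "(SOME b. b \<in> {1..K} \<and> y \<in> solutions (PHP m n) (F' b)) = a"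
      by (rule some_equality) (use a y unique in blast)+
    then show "\<exists>z. G y = Some z \<and> z \<in> solutions (id_problem K) a"
      by (simp add: G_def id_problem_def)
  qed
qed

section \<open>Counting\<close>

lemma bij_betw_if_inj_on_card_eq:
  assumes "inj_on f A" "f \<in> A \<rightarrow> B" "finite B" "card A = card B"
  shows "bij_betw f A B"
  using assms card_subset_eq[of B "f ` A"] by (auto simp: bij_betw_def card_image)

text \<open>\<open>id_problem 2\<close> is the test problem that separates
  \<open>PHP (n ^ 2 + 1) n\<close> from \<open>PHP (n ^ 2) n\<close>.\<close>

lemma not_id_2_le_PHP:
  assumes "n ^ 2 < m"
  shows "\<not> id_problem 2 \<le>\<^sub>P PHP m n"
proof
  assume "id_problem 2 \<le>\<^sub>P PHP m n"
  then obtain F where "\<forall>a\<in>{1..2::nat}. F a \<in> {..<m} \<rightarrow> {..<n}"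
    and inj: "\<forall>a\<in>{1..2}. \<forall>b\<in>{1..2}. a \<noteq> b \<longrightarrow> inj_on (\<lambda>x. (F a x, F b x)) {..<m}"
    unfolding id_le_PHP_iff by blast
  then have "(\<lambda>x. (F 1 x, F 2 x)) ` {..<m} \<subseteq> {..<n} \<times> {..<n}"
    by auto
  moreover have "inj_on (\<lambda>x. (F 1 x, F 2 x)) {..<m}"
    using inj by simp
  ultimately have "card {..<m} \<le> card ({..<n} \<times> {..<n})"
    by (intro card_inj_on_le) auto
  then show False
    using assms by (simp add: power2_eq_square)
qed

section \<open>From orthogonal Latin squares to a reduction\<close>

lemma id_le_PHP_if_MOLS:
  assumes "mutually_orthogonal_latin_squares k n L"
  shows "id_problem (k + 2) \<le>\<^sub>P PHP (n ^ 2) n"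
proof -
  \<comment> \<open>The number \<open>x\<close> encodes the cell in row \<open>x div n\<close> and
    column \<open>x mod n\<close>. Instances of \<open>id_problem\<close> start at 1, so 1 and 2
    stand for the coordinates and \<open>a\<close> from 3 on for the square with index
    \<open>a - 3\<close>.\<close>
  define F where "F a x =
    (if a = 1 then x div n else if a = 2 then x mod n else L (a - 3) (x div n) (x mod n))"
    for a x :: nat
  have coords: "x div n < n" "x mod n < n" if "x < n ^ 2" for x
    using that by (cases "n = 0"; simp add: power2_eq_square less_mult_imp_div_less)+
  have row: "bij_betw (L c i) {..<n} {..<n}"
    and column: "bij_betw (\<lambda>i. L c i j) {..<n} {..<n}" if "c < k" "i < n" "j < n" for c i j
    using assms that
    by (auto simp: mutually_orthogonal_latin_squares_def latin_square_def)
  have orth: "inj_on (\<lambda>(i, j). (L c i j, L d i j)) ({..<n} \<times> {..<n})"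
    if "c < k" "d < k" "c \<noteq> d" for c d
    using assms that
    by (auto simp: mutually_orthogonal_latin_squares_def orthogonal_squares_def bij_betw_def)
  have range: "F a x < n" if "a \<in> {1..k + 2}" "x < n ^ 2" for a x
  proof (cases "a \<le> 2")
    case True
    then have "a = 1 \<or> a = 2"
      using that by auto
    then show ?thesis
      using coords[OF that(2)] by (auto simp: F_def)
  next
    case False
    then have "a - 3 < k"
      using that by auto
    then have "L (a - 3) (x div n) (x mod n) < n"
      using row coords[OF that(2)] by (blast dest: bij_betwE)
    then show ?thesis
      using False by (simp add: F_def)
  qed
  \<comment> \<open>By symmetry \<open>a < b\<close>. Two coordinates determine the cell; a row or
    column coordinate together with a square does so because lines of a Latin square are injective;
    two squares do so by orthogonality.\<close>
  have collision: "x = y"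
    if "1 \<le> a" "a < b" "b \<le> k + 2" and xy: "x < n ^ 2" "y < n ^ 2"
      and eq: "F a x = F a y" "F b x = F b y" for a b x y
  proof -
    have "x div n = y div n \<and> x mod n = y mod n"
    proof (cases "b = 2")
      case True
      with that have "a = 1"
        by simp
      with True eq show ?thesis
        by (simp add: F_def)
    next
      case False
      with that have b: "b > 2" and bk: "b - 3 < k"
        by auto
      then have eqb: "L (b - 3) (x div n) (x mod n) = L (b - 3) (y div n) (y mod n)"
        using eq by (simp add: F_def)
      consider "a = 1" | "a = 2" | "a > 2"
        using \<open>1 \<le> a\<close> by linarith
      then show ?thesis
      proof cases
        case 1
        then have "x div n = y div n"
          using eq by (simp add: F_def)
        moreover have "inj_on (L (b - 3) (x div n)) {..<n}"
          using row bk coords[OF xy(1)] by (blast dest: bij_betw_imp_inj_on)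
        ultimately show ?thesis
          using eqb coords[OF xy(1)] coords[OF xy(2)] by (auto dest: inj_onD)
      next
        case 2
        then have "x mod n = y mod n"
          using eq by (simp add: F_def)
        moreover have "inj_on (\<lambda>i. L (b - 3) i (x mod n)) {..<n}"
          using column bk coords[OF xy(1)] by (blast dest: bij_betw_imp_inj_on)
        ultimately show ?thesis
          using eqb coords[OF xy(1)] coords[OF xy(2)] by (auto dest: inj_onD)
      next
        case 3
        then have "L (a - 3) (x div n) (x mod n) = L (a - 3) (y div n) (y mod n)"
          using eq by (simp add: F_def)
        moreover have "inj_on (\<lambda>(i, j). (L (a - 3) i j, L (b - 3) i j)) ({..<n} \<times> {..<n})"
          using 3 that bk by (intro orth) auto
        ultimately show ?thesis
          using eqb coords[OF xy(1)] coords[OF xy(2)]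
            inj_onD[of _ _ "(x div n, x mod n)" "(y div n, y mod n)"] by fastforce
      qed
    qed
    then show ?thesis
      by (metis div_mult_mod_eq)
  qed
  have "inj_on (\<lambda>x. (F a x, F b x)) {..<n ^ 2}"
    if "a \<in> {1..k + 2}" "b \<in> {1..k + 2}" "a \<noteq> b" for a b
  proof (rule inj_onI)
    fix x y assume "x \<in> {..<n ^ 2}" "y \<in> {..<n ^ 2}" "(F a x, F b x) = (F a y, F b y)"
    with that show "x = y"
      by (cases "a < b") (auto intro: collision[of a b] collision[of b a])
  qed
  then show ?thesis
    unfolding id_le_PHP_iff using range by (intro exI[of _ F]) auto
qed

section \<open>From a reduction to orthogonal Latin squares\<close>

lemma MOLS_if_id_le_PHP:
  assumes "id_problem (k + 2) \<le>\<^sub>P PHP (n ^ 2) n"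
  shows "\<exists>L. mutually_orthogonal_latin_squares k n L"
proof -
  obtain F where F: "\<And>a. a \<in> {1..k + 2} \<Longrightarrow> F a \<in> {..<n ^ 2} \<rightarrow> {..<n}"
    and inj: "\<And>a b. a \<in> {1..k + 2} \<Longrightarrow> b \<in> {1..k + 2} \<Longrightarrow> a \<noteq> b \<Longrightarrow>
                inj_on (\<lambda>x. (F a x, F b x)) {..<n ^ 2}"
    using assms unfolding id_le_PHP_iff by blast
  have bij: "bij_betw (\<lambda>x. (F a x, F b x)) {..<n ^ 2} ({..<n} \<times> {..<n})"
    if "a \<in> {1..k + 2}" "b \<in> {1..k + 2}" "a \<noteq> b" for a b
    using inj[OF that] F[OF that(1)] F[OF that(2)]
    by (intro bij_betw_if_inj_on_card_eq) (auto simp: power2_eq_square)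
  \<comment> \<open>\<open>g\<close> maps the cell \<open>(i, j)\<close> to the unique pigeon on
    which \<open>F 1\<close> is \<open>i\<close> and \<open>F 2\<close> is \<open>j\<close>.\<close>
  define g where "g = inv_into {..<n ^ 2} (\<lambda>x. (F 1 x, F 2 x))"
  have F12: "bij_betw (\<lambda>x. (F 1 x, F 2 x)) {..<n ^ 2} ({..<n} \<times> {..<n})"
    by (rule bij) auto
  then have g: "bij_betw g ({..<n} \<times> {..<n}) {..<n ^ 2}"
    unfolding g_def by (rule bij_betw_inv_into)
  have F_g: "F 1 (g (i, j)) = i" "F 2 (g (i, j)) = j" if "i < n" "j < n" for i j
    using bij_betw_inv_into_right[OF F12, of "(i, j)"] that by (auto simp: g_def)
  have g_range: "g (i, j) < n ^ 2" if "i < n" "j < n" for i j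
    using bij_betwE[OF g] that by auto
  have inj_g: "inj_on g ({..<n} \<times> {..<n})"
    using g by (rule bij_betw_imp_inj_on)
  define L where "L c i j = F (c + 3) (g (i, j))" for c i j
  have L_range: "L c i j < n" if "c < k" "i < n" "j < n" for c i j
    using F[of "c + 3"] g_range that by (auto simp: L_def)
  have "latin_square n (L c)" if c: "c < k" for c
    unfolding latin_square_def
  proof (intro conjI allI impI)
    fix i assume i: "i < n"
    have "inj_on (L c i) {..<n}"
    proof (rule inj_onI)
      fix j j' assume j: "j \<in> {..<n}" "j' \<in> {..<n}" and eq: "L c i j = L c i j'"
      \<comment> \<open>Along row \<open>i\<close> the value of \<open>F 1\<close> is constant, so a
        repeated entry would be a common collision of \<open>F 1\<close> and
        \<open>F (c + 3)\<close>. Columns use \<open>F 2\<close> in the same way.\<close>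
      have "inj_on (\<lambda>x. (F 1 x, F (c + 3) x)) {..<n ^ 2}"
        using c by (intro inj) auto
      from inj_onD[OF this, of "g (i, j)" "g (i, j')"] have "g (i, j) = g (i, j')"
        using eq i j g_range F_g by (simp add: L_def)
      then show "j = j'"
        using i j F_g(2) by (metis lessThan_iff)
    qed
    then show "bij_betw (\<lambda>j. L c i j) {..<n} {..<n}"
      using L_range c i by (intro bij_betw_if_inj_on_card_eq) auto
  next
    fix j assume j: "j < n"
    have "inj_on (\<lambda>i. L c i j) {..<n}"
    proof (rule inj_onI)
      fix i i' assume i: "i \<in> {..<n}" "i' \<in> {..<n}" and eq: "L c i j = L c i' j"
      have "inj_on (\<lambda>x. (F 2 x, F (c + 3) x)) {..<n ^ 2}"
        using c by (intro inj) auto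
      from inj_onD[OF this, of "g (i, j)" "g (i', j)"] have "g (i, j) = g (i', j)"
        using eq i j g_range F_g by (simp add: L_def)
      then show "i = i'"
        using i j F_g(1) by (metis lessThan_iff)
    qed
    then show "bij_betw (\<lambda>i. L c i j) {..<n} {..<n}"
      using L_range c j by (intro bij_betw_if_inj_on_card_eq) auto
  qed
  moreover have "orthogonal_squares n (L c) (L d)" if "c < k" "d < k" "c \<noteq> d" for c d
  proof -
    have "bij_betw (\<lambda>x. (F (c + 3) x, F (d + 3) x)) {..<n ^ 2} ({..<n} \<times> {..<n})"
      using that by (intro bij) auto
    \<comment> \<open>Superimposing two squares is the joint map of their functions, precomposed
      with the change of coordinates \<open>g\<close>.\<close>
    from bij_betw_trans[OF g this] show ?thesis
      by (simp add: orthogonal_squares_def L_def comp_def case_prod_unfold)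
  qed
  ultimately show ?thesis
    unfolding mutually_orthogonal_latin_squares_def by blast
qed

section \<open>The cyclic square and the strict inequality\<close>

lemma latin_square_cyclic: "latin_square n (\<lambda>i j. (i + j) mod n)"
proof -
  have "bij_betw (\<lambda>j. (i + j) mod n) {..<n} {..<n}" for i
  proof (rule bij_betw_if_inj_on_card_eq)
    show "inj_on (\<lambda>j. (i + j) mod n) {..<n}"
    proof (rule linorder_inj_onI')
      fix j j' assume j: "j \<in> {..<n}" "j' \<in> {..<n}" "j < j'"
      show "(i + j) mod n \<noteq> (i + j') mod n"
      proof
        assume "(i + j) mod n = (i + j') mod n"
        \<comment> \<open>This difference is \<open>j' - j\<close>, which lies strictly between 0
          and \<open>n\<close>.\<close>
        then have "n dvd (i + j') - (i + j)"
          using j by (intro mod_eq_dvd_iff_nat[THEN iffD1]) auto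
        then show False
          using j by (auto dest: dvd_imp_le)
      qed
    qed
  qed auto
  \<comment> \<open>The square is symmetric in \<open>i\<close> and \<open>j\<close>, so its columns
    are its rows.\<close>
  then show ?thesis
    by (simp add: latin_square_def add.commute)
qed

text \<open>This is the case of a single square, where orthogonality is vacuous and the cyclic
  square suffices for every order.\<close>

lemma id_3_le_PHP: "id_problem 3 \<le>\<^sub>P PHP (n ^ 2) n"
proof -
  have "mutually_orthogonal_latin_squares 1 n (\<lambda>_ i j. (i + j) mod n)"
    by (simp add: mutually_orthogonal_latin_squares_def latin_square_cyclic)
  then show ?thesis
    using id_le_PHP_if_MOLS[of 1] by (simp add: numeral_3_eq_3)
qed

theorem theorem2p11:
  fixes k n :: nat
  assumes "k \<ge> 1" and "n \<ge> 2"
  shows "((\<exists>L. mutually_orthogonal_latin_squares k n L) \<longleftrightarrow>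
            id_problem (k + 2) \<le>\<^sub>P PHP (n ^ 2) n) \<and>
         id_problem 3 \<le>\<^sub>P PHP (n ^ 2) n \<and>
         PHP (n ^ 2 + 1) n <\<^sub>P PHP (n ^ 2) n"
proof (intro conjI)
  show "(\<exists>L. mutually_orthogonal_latin_squares k n L) \<longleftrightarrow>
          id_problem (k + 2) \<le>\<^sub>P PHP (n ^ 2) n"
    using id_le_PHP_if_MOLS MOLS_if_id_le_PHP by blast
  show "id_problem 3 \<le>\<^sub>P PHP (n ^ 2) n"
    by (rule id_3_le_PHP)
  \<comment> \<open>A reduction of \<open>PHP (n ^ 2) n\<close> to \<open>PHP (n ^ 2 + 1) n\<close>
    would carry \<open>id_problem 2\<close> along, against the counting bound.\<close>
  have "id_problem 2 \<le>\<^sub>P PHP (n ^ 2) n"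
    using id_problem_mono[of 2 3] id_3_le_PHP by (auto intro: problem_le_trans)
  then have "\<not> PHP (n ^ 2) n \<le>\<^sub>P PHP (n ^ 2 + 1) n"
    using not_id_2_le_PHP[of n "n ^ 2 + 1"] by (auto intro: problem_le_trans)
  then show "PHP (n ^ 2 + 1) n <\<^sub>P PHP (n ^ 2) n"
    unfolding problem_less_def using PHP_antimono[of "n ^ 2" "n ^ 2 + 1" n] by simp
qed

end
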